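(* Let $k>1$ be an integer. The $k$-Lagrange spectrum $\mathcal{L}_k$ is dense in $(\tfrac{\sqrt5}{2k-1},\infty)$.
   Context: The Sturmian word of slope $\alpha$ (irrational) and intercept $x\in[0,1)$ has $n$-th letter ($n\ge0$) $0$ if $\{x+n\alpha\}\in[0,\{1-\alpha\})$ and $1$ otherwise (or the analogous left-open convention), $\{\cdot\}$ the fractional part. Two words are $k$-abelian equivalent if every nonempty word of length at most $k$ occurs as a factor equally often in both. A $k$-abelian power of period $m$ and exponent $n$ is a concatenation of $n$ pairwise $k$-abelian equivalent words of length $m$. $\mathrm{ab}_{k,\alpha}(m)$ is the maximum exponent of a $k$-abelian power of period $m$ occurring in a Sturmian word of slope $\alpha$, and $A_k(\alpha)=\limsup_{m\to\infty}\mathrm{ab}_{k,\alpha}(m)/m$. The $k$-Lagrange spectrum is $\mathcal{L}_k=\{A_k(\alpha):\alpha \text{ irrational}\}\cap\mathbb{R}$. *)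

theory Defs
  imports "HOL-Analysis.Analysis"
begin

(* Infinite words are functions from nat, finite words are lists; letters are 0 and 1. *)

definition sturmian_word :: "real \<Rightarrow> real \<Rightarrow> nat \<Rightarrow> nat" where
  "sturmian_word \<alpha> x n =
     (if frac (x + real n * \<alpha>) \<in> {0..<frac (1 - \<alpha>)} then 0 else 1)"

(* The left-open convention: the circle is split into (0, {1 - \<alpha>}] and ({1 - \<alpha>}, 1],
   where the point 1 is identified with 0; so a fractional part equal to 0 gives the letter 1. *)
definition sturmian_word_left_open :: "real \<Rightarrow> real \<Rightarrow> nat \<Rightarrow> nat" where
  "sturmian_word_left_open \<alpha> x n =
     (if frac (x + real n * \<alpha>) \<in> {0<..frac (1 - \<alpha>)} then 0 else 1)"

definition sturmian_words :: "real \<Rightarrow> (nat \<Rightarrow> nat) set" where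
  "sturmian_words \<alpha> =
     sturmian_word \<alpha> ` {0..<1} \<union> sturmian_word_left_open \<alpha> ` {0..<1}"

definition occurs_in :: "'a list \<Rightarrow> (nat \<Rightarrow> 'a) \<Rightarrow> bool" where
  "occurs_in w s \<longleftrightarrow> (\<exists>i. w = map s [i..<i + length w])"

(* Occurrences are counted by position, so they may overlap. *)
definition occurrences :: "'a list \<Rightarrow> 'a list \<Rightarrow> nat" where
  "occurrences w u = card {i. i + length w \<le> length u \<and> take (length w) (drop i u) = w}"

definition k_abelian_equiv :: "nat \<Rightarrow> 'a list \<Rightarrow> 'a list \<Rightarrow> bool" where
  "k_abelian_equiv k u v \<longleftrightarrow>
     (\<forall>w. w \<noteq> [] \<and> length w \<le> k \<longrightarrow> occurrences w u = occurrences w v)"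

definition k_abelian_power :: "nat \<Rightarrow> nat \<Rightarrow> nat \<Rightarrow> 'a list \<Rightarrow> bool" where
  "k_abelian_power k m n w \<longleftrightarrow>
     (\<exists>us. w = concat us \<and> length us = n \<and> (\<forall>u\<in>set us. length u = m) \<and>
           (\<forall>u\<in>set us. \<forall>v\<in>set us. k_abelian_equiv k u v))"

(* For irrational \<alpha> and m \<ge> 1 the exponents are bounded, so the supremum is the maximum;
   taking it in enat avoids the arbitrary value that Max has on infinite sets. *)
definition ab :: "nat \<Rightarrow> real \<Rightarrow> nat \<Rightarrow> enat" where
  "ab k \<alpha> m =
     (SUP n \<in> {n. \<exists>s \<in> sturmian_words \<alpha>. \<exists>w. occurs_in w s \<and> k_abelian_power k m n w}. enat n)"

definition A_const :: "nat \<Rightarrow> real \<Rightarrow> ereal" where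
  "A_const k \<alpha> = limsup (\<lambda>m. ereal_of_enat (ab k \<alpha> m) / ereal (real m))"

definition Lagrange_spectrum :: "nat \<Rightarrow> real set" where
  "Lagrange_spectrum k = {r. \<exists>\<alpha>. \<alpha> \<notin> \<rat> \<and> A_const k \<alpha> = ereal r}"

end

theory Submission
  imports Defs
begin

text \<open>For irrational \<open>0 < \<alpha> < 1 / (2k - 1)\<close> two consecutive ones of a Sturmian word of slope \<open>\<alpha>\<close> are
  so far apart that a factor of length at most \<open>k\<close> contains at most one of them. Hence blocks are
  \<open>k\<close>-abelian equivalent iff shortening them by \<open>a\<close> letters on the left and \<open>b\<close> on the right always leaves
  equally many ones (\<open>a + b < k\<close>). In terms of the rotation by \<open>\<alpha>\<close> this says that the starting points
  of the blocks, which are spaced by \<open>\<parallel>m\<alpha>\<parallel>\<close>, lie between the same two of the points \<open>j\<alpha>\<close>, \<open>\<bar>j\<bar> < k\<close>,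
  up to bounded errors. The longest gap between these points is \<open>1 - (2k - 2)\<alpha>\<close>, so
  \<open>A\<^sub>k(\<alpha>) = (1 - (2k - 2)\<alpha>) \<Lambda>\<close> with \<open>\<Lambda> = limsup 1 / (m \<parallel>m\<alpha>\<parallel>)\<close>.

  The numbers equivalent to the metallic mean with partial quotients \<open>n\<close> are dense and share the value
  \<open>\<Lambda> = sqrt (n\<^sup>2 + 4)\<close>. As the ratio of consecutive such values is less than \<open>3 \<le> 2k - 1\<close>, every
  \<open>t > sqrt 5 / (2k - 1)\<close> satisfies \<open>\<Lambda> / (2k - 1) < t < \<Lambda>\<close> for some \<open>n\<close>, and it remains to take \<open>\<alpha>\<close> near
  the solution of \<open>(1 - (2k - 2)\<alpha>) \<Lambda> = t\<close>.\<close>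

section \<open>A dense set of slopes with the same Lagrange constant\<close>

definition dist_int :: "real \<Rightarrow> real" where
  "dist_int a = \<bar>a - of_int (round a)\<bar>"

lemma dist_int_le: "dist_int a \<le> \<bar>a - of_int c\<bar>"
  unfolding dist_int_def by (rule round_diff_minimal)

lemma dist_int_le_half: "dist_int a \<le> 1 / 2"
  unfolding dist_int_def using of_int_round_abs_le[of a] by (simp add: abs_minus_commute)

lemma dist_int_pos: "a \<notin> \<rat> \<Longrightarrow> 0 < dist_int a"
  unfolding dist_int_def by (metis Rats_of_int eq_iff_diff_eq_0 zero_less_abs_iff)

lemma irrational_nat_mult:
  assumes "\<alpha> \<notin> \<rat>" "m > 0"
  shows "real m * \<alpha> \<notin> \<rat>"
proof
  assume "real m * \<alpha> \<in> \<rat>"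
  then have "real m * \<alpha> / real m \<in> \<rat>" by (intro Rats_divide) auto
  then show False using assms by simp
qed

section \<open>Metallic means, their conjugates and the norm form\<close>

text \<open>The positive root of \<open>X^2 = n X + 1\<close>; for \<open>n > 0\<close> all its
  partial quotients equal \<open>n\<close>. The other root is
  \<open>real n - metallic n\<close>.\<close>

definition metallic :: "nat \<Rightarrow> real" where
  "metallic n = (real n + sqrt (real n ^ 2 + 4)) / 2"

lemma metallic_mult_conj: "metallic n * (real n - metallic n) = -1"
proof -
  define S where "S = sqrt (real n ^ 2 + 4)"
  have "metallic n * (real n - metallic n) = (real n ^ 2 - S ^ 2) / 4"
    unfolding metallic_def S_def[symmetric] by (simp add: field_simps power2_eq_square)
  moreover have "S ^ 2 = real n ^ 2 + 4" unfolding S_def by simp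
  ultimately show ?thesis by simp
qed

lemma metallic_gt_1: "n > 0 \<Longrightarrow> metallic n > 1"
proof -
  assume "n > 0"
  then have "real n \<ge> 1" by simp
  moreover have "sqrt (real n ^ 2 + 4) > 1" by (simp add: add_pos_nonneg)
  ultimately have "1 + 1 < real n + sqrt (real n ^ 2 + 4)" by (rule add_le_less_mono)
  then show ?thesis unfolding metallic_def by simp
qed

lemma abs_metallic_conj:
  assumes "n > 0"
  shows "\<bar>real n - metallic n\<bar> = 1 / metallic n"
proof -
  have t: "metallic n > 0" using metallic_gt_1[OF assms] by simp
  have "real n - metallic n = -1 / metallic n"
    using metallic_mult_conj[of n] t by (metis less_irrefl nonzero_mult_div_cancel_left)
  then show ?thesis using t by simp
qed

text \<open>Both roots satisfy \<open>X^2 = n X + 1\<close>, so one recursion for the coefficients,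
  from \<open>(x, y)\<close> to \<open>(n x + y, x)\<close>, serves both. For \<open>n > 0\<close>
  the same pair thus gives a combination tending to \<open>0\<close> together with its growing
  conjugate.\<close>

lemma metallic_powers:
  "\<exists>x y :: int. (real n - metallic n) ^ j = of_int x - of_int y * metallic n \<and>
                metallic n ^ j = of_int x - of_int y * (real n - metallic n)"
proof (induction j)
  case 0
  show ?case by (rule exI[of _ 1], rule exI[of _ 0]) simp
next
  case (Suc j)
  let ?t = "metallic n"
  from Suc obtain x y :: int where
    1: "(real n - ?t) ^ j = of_int x - of_int y * ?t" and
    2: "?t ^ j = of_int x - of_int y * (real n - ?t)" by blast
  have sq: "?t * ?t = real n * ?t + 1" using metallic_mult_conj[of n] by (simp add: algebra_simps)
  show ?case
  proof (intro exI conjI)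
    have "(of_int x - of_int y * ?t) * (real n - ?t) =
        real n * of_int x - of_int x * ?t - real n * of_int y * ?t + of_int y * (?t * ?t)"
      by (simp add: algebra_simps)
    also have "\<dots> = of_int (int n * x + y) - of_int x * ?t"
      unfolding sq by (simp add: algebra_simps)
    finally show "(real n - ?t) ^ Suc j = of_int (int n * x + y) - of_int x * ?t"
      unfolding power_Suc2 1 .
    have "(of_int x - of_int y * (real n - ?t)) * ?t =
        of_int x * ?t - real n * of_int y * ?t + of_int y * (?t * ?t)"
      by (simp add: algebra_simps)
    also have "\<dots> = of_int (int n * x + y) - of_int x * (real n - ?t)"
      unfolding sq by (simp add: algebra_simps)
    finally show "?t ^ Suc j = of_int (int n * x + y) - of_int x * (real n - ?t)"
      unfolding power_Suc2 2 .
  qed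
qed

text \<open>The powers of the conjugate are nonzero integer combinations of \<open>1\<close> and the number itself
  that tend to \<open>0\<close>, which is impossible for a rational number.\<close>

lemma metallic_irrational:
  assumes "n > 0"
  shows "metallic n \<notin> \<rat>"
proof
  let ?t = "metallic n"
  assume "?t \<in> \<rat>"
  then obtain a b :: int where ab: "b > 0" "?t = of_int a / of_int b"
    by (metis Rats_cases')
  have t1: "?t > 1" using metallic_gt_1 assms by blast
  obtain j where j: "?t ^ j > of_int b" using real_arch_pow[OF t1] by blast
  obtain x y :: int where xy: "(real n - ?t) ^ j = of_int x - of_int y * ?t"
    using metallic_powers by blast
  have "of_int b * (real n - ?t) ^ j = of_int (b * x - y * a)"
    unfolding xy using ab by (simp add: field_simps)
  moreover have "\<bar>of_int b * (real n - ?t) ^ j\<bar> = of_int b / ?t ^ j"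
    using ab(1) t1 unfolding abs_mult power_abs abs_metallic_conj[OF assms]
    by (simp add: power_divide)
  moreover have "of_int b / ?t ^ j < 1" "0 < of_int b / ?t ^ j" using j t1 ab(1) by simp_all
  ultimately have "0 < real_of_int \<bar>b * x - y * a\<bar>" "real_of_int \<bar>b * x - y * a\<bar> < 1"
    by (simp_all only: of_int_abs)
  then have "0 < \<bar>b * x - y * a\<bar>" "\<bar>b * x - y * a\<bar> < 1"
    by (simp_all only: of_int_0_less_iff of_int_less_1_iff)
  then show False by linarith
qed

lemma int_combination_irrational:
  assumes "t \<notin> \<rat>" "of_int a * t = (of_int b :: real)"
  shows "a = 0 \<and> b = 0"
proof (cases "a = 0")
  case True
  then show ?thesis using assms by simp
next
  case False
  then have "t = of_int b / of_int a" using assms(2) by (simp add: field_simps)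
  then have "t \<in> \<rat>" by (metis Rats_divide Rats_of_int)
  then show ?thesis using assms by simp
qed

text \<open>The product is the norm form \<open>u^2 - n u v - v^2\<close>, an integer, and it
  vanishes only at the origin because the metallic mean is irrational.\<close>

lemma metallic_norm_ge_1:
  assumes "n > 0" "u \<noteq> 0 \<or> v \<noteq> (0::int)"
  shows "\<bar>(metallic n * of_int v - of_int u) * ((real n - metallic n) * of_int v - of_int u)\<bar> \<ge> 1"
proof -
  let ?t = "metallic n"
  have "(?t * of_int v - of_int u) * ((real n - ?t) * of_int v - of_int u) =
      of_int v * of_int v * (?t * (real n - ?t)) - of_int u * of_int v * real n + of_int u * of_int u"
    by (simp add: algebra_simps)
  also have "\<dots> = of_int (u * u - int n * u * v - v * v)"
    unfolding metallic_mult_conj by (simp add: algebra_simps)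
  finally have eq: "(?t * of_int v - of_int u) * ((real n - ?t) * of_int v - of_int u) =
      of_int (u * u - int n * u * v - v * v)" .
  have "?t * of_int v - of_int u \<noteq> 0"
    using int_combination_irrational[OF metallic_irrational[OF assms(1)], of v u] assms(2)
    by (auto simp: mult.commute)
  moreover have "(real n - ?t) * of_int v - of_int u \<noteq> 0"
  proof
    assume "(real n - ?t) * of_int v - of_int u = 0"
    then have "of_int v * ?t = of_int (int n * v - u)" by (simp add: algebra_simps)
    from int_combination_irrational[OF metallic_irrational[OF assms(1)] this]
    show False using assms(2) by auto
  qed
  ultimately have "u * u - int n * u * v - v * v \<noteq> 0" using eq by (metis mult_eq_0_iff of_int_0)
  then show ?thesis unfolding eq by linarith
qed

section \<open>Approximation of Moebius images of metallic means\<close>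

text \<open>The matrix with rows \<open>(p, r)\<close> and \<open>(q, s)\<close> acts on both roots;
  \<open>E\<close> and \<open>E'\<close> are the denominators, and \<open>D\<close> equals
  \<open>t - t'\<close>. In the two estimates below \<open>K\<close> enters only the error terms, so
  the leading term \<open>D\<close> is the same for all matrices.\<close>

context
  fixes n :: nat and p q r s :: int and t t' E E' \<alpha> \<alpha>' K D :: real
  assumes n: "n > 0" and det: "p * s - q * r = 1"
  defines "t \<equiv> metallic n" and "t' \<equiv> real n - t"
    and "E \<equiv> of_int q * t + of_int s" and "E' \<equiv> of_int q * t' + of_int s"
    and "\<alpha> \<equiv> (of_int p * t + of_int r) / E" and "\<alpha>' \<equiv> (of_int p * t' + of_int r) / E'"
    and "K \<equiv> \<bar>E * E'\<bar>" and "D \<equiv> sqrt (real n ^ 2 + 4)"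
begin

lemma denominators_nonzero: "E \<noteq> 0" "E' \<noteq> 0"
proof -
  have qs: "q \<noteq> 0 \<or> -s \<noteq> 0" using det by auto
  have "E * E' = (metallic n * of_int q - of_int (-s)) * ((real n - metallic n) * of_int q - of_int (-s))"
    unfolding E_def E'_def t_def t'_def by (simp add: mult.commute)
  then have "\<bar>E * E'\<bar> \<ge> 1" using metallic_norm_ge_1[OF n, of "-s" q] qs by fastforce
  then show "E \<noteq> 0" "E' \<noteq> 0" by auto
qed

lemma K_pos: "K > 0"
  using denominators_nonzero by (simp add: K_def)

text \<open>A Moebius map of determinant \<open>1\<close> divides the difference of two points by
  the product of their denominators.\<close>

lemma diff_conj: "K * \<bar>\<alpha> - \<alpha>'\<bar> = D"
proof -
  have "E * E' * (\<alpha> - \<alpha>') = (of_int p * t + of_int r) * E' - (of_int p * t' + of_int r) * E"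
    using denominators_nonzero by (simp add: \<alpha>_def \<alpha>'_def field_simps)
  also have "\<dots> = (of_int (p * s - q * r)) * (t - t')"
    unfolding E_def E'_def by (simp add: algebra_simps)
  also have "\<dots> = D" unfolding det t'_def t_def metallic_def D_def by (simp add: field_simps)
  finally have "\<bar>E * E' * (\<alpha> - \<alpha>')\<bar> = \<bar>D\<bar>" by simp
  then show ?thesis unfolding K_def D_def by (simp add: abs_mult)
qed

text \<open>A linear change of variables: up to the factor \<open>E\<close>, approximating
  \<open>\<alpha>\<close> by \<open>X / Y\<close> is approximating \<open>t\<close> by
  \<open>u / v\<close> with \<open>u = Y r - X s\<close> and \<open>v = X q - Y p\<close>. The
  product of both identities is therefore a value of the norm form.\<close>

lemma factor_transform:
  "(of_int X - \<alpha> * of_int Y) * E = t * of_int (X * q - Y * p) - of_int (Y * r - X * s)"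
  "(of_int X - \<alpha>' * of_int Y) * E' = t' * of_int (X * q - Y * p) - of_int (Y * r - X * s)"
  using denominators_nonzero by (simp_all add: \<alpha>_def \<alpha>'_def field_simps)
   (simp_all add: E_def E'_def algebra_simps)

lemma mobius_irrational: "\<alpha> \<notin> \<rat>"
proof
  assume "\<alpha> \<in> \<rat>"
  then obtain a b :: int where ab: "b > 0" "\<alpha> = of_int a / of_int b" by (metis Rats_cases')
  have "(of_int a - \<alpha> * of_int b) * E = 0" using ab by simp
  then have "of_int (a * q - b * p) * t = of_int (b * r - a * s)"
    unfolding factor_transform by (simp add: algebra_simps)
  then have z: "a * q = b * p" "b * r = a * s"
    using int_combination_irrational[OF metallic_irrational[OF n]] unfolding t_def by fastforce+
  have "b = b * (p * s - q * r)" using det by simp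
  also have "\<dots> = (b * p) * s - (b * r) * q" by (simp add: algebra_simps)
  also have "\<dots> = 0" unfolding z(1)[symmetric] z(2) by simp
  finally show False using ab by simp
qed

lemma conj_factor_le:
  "\<bar>of_int X - \<alpha>' * of_int Y\<bar> \<le> \<bar>of_int X - \<alpha> * of_int Y\<bar> + \<bar>\<alpha> - \<alpha>'\<bar> * \<bar>of_int Y\<bar>"
proof -
  have "of_int X - \<alpha>' * of_int Y = (of_int X - \<alpha> * of_int Y) + (\<alpha> - \<alpha>') * of_int Y"
    by (simp add: algebra_simps)
  then show ?thesis by (metis abs_mult abs_triangle_ineq)
qed

lemma conj_factor_ge:
  "\<bar>\<alpha> - \<alpha>'\<bar> * \<bar>of_int Y\<bar> \<le> \<bar>of_int X - \<alpha>' * of_int Y\<bar> + \<bar>of_int X - \<alpha> * of_int Y\<bar>"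
proof -
  have "(\<alpha> - \<alpha>') * of_int Y = (of_int X - \<alpha>' * of_int Y) - (of_int X - \<alpha> * of_int Y)"
    by (simp add: algebra_simps)
  then show ?thesis by (metis abs_mult abs_triangle_ineq4)
qed

text \<open>The norm form is at least \<open>1\<close> in absolute value, so
  \<open>K d \<bar>X - \<alpha>' m\<bar> \<ge> 1\<close>. The last factor is at most
  \<open>d + \<bar>\<alpha> - \<alpha>'\<bar> m\<close>, and \<open>diff_conj\<close> turns this
  into \<open>1 \<le> K d^2 + D m d\<close>.\<close>

lemma approx_lower:
  assumes "m > 0"
  shows "1 / (real m * dist_int (real m * \<alpha>)) \<le> D + K / real m"
proof -
  define d where "d = dist_int (real m * \<alpha>)"
  define X where "X = round (real m * \<alpha>)"
  have dX: "d = \<bar>of_int X - \<alpha> * of_int (int m)\<bar>"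
    by (simp add: d_def X_def dist_int_def algebra_simps abs_minus_commute)
  have d0: "d > 0" using dist_int_pos irrational_nat_mult mobius_irrational assms d_def by blast
  have d1: "d \<le> 1" using dist_int_le_half[of "real m * \<alpha>"] d_def by simp
  have uv: "int m * r - X * s \<noteq> 0 \<or> X * q - int m * p \<noteq> 0"
  proof (rule ccontr)
    assume "\<not> ?thesis"
    then have "(of_int X - \<alpha> * of_int (int m)) * E = 0" unfolding factor_transform by simp
    then show False using denominators_nonzero d0 dX by auto
  qed
  have "1 \<le> \<bar>((of_int X - \<alpha> * of_int (int m)) * E) * ((of_int X - \<alpha>' * of_int (int m)) * E')\<bar>"
    unfolding factor_transform unfolding t_def t'_def using metallic_norm_ge_1[OF n uv] by simp
  also have "\<dots> = K * d * \<bar>of_int X - \<alpha>' * of_int (int m)\<bar>"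
    by (simp add: K_def dX abs_mult)
  also have "\<dots> \<le> K * d * (d + \<bar>\<alpha> - \<alpha>'\<bar> * real m)"
    using conj_factor_le[of X "int m"] K_pos d0 unfolding dX by (intro mult_left_mono) auto
  also have "\<dots> = K * d * d + (K * \<bar>\<alpha> - \<alpha>'\<bar>) * real m * d" by (simp add: algebra_simps)
  also have "\<dots> \<le> K * 1 * d + D * real m * d"
    unfolding diff_conj using d1 d0 K_pos by (intro add_right_mono mult_right_mono mult_left_mono) auto
  finally show ?thesis using d0 assms unfolding d_def[symmetric] by (simp add: field_simps)
qed

text \<open>Powers of the conjugate are units, where the norm form is \<open>1\<close> or
  \<open>-1\<close>, so the estimate of \<open>approx_lower\<close> is nearly sharp there. They tend
  to \<open>0\<close>, which forces the denominators to grow.\<close>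

lemma approx_upper:
  "\<exists>m>M. 1 / (real m * dist_int (real m * \<alpha>)) \<ge> D - K / real m"
proof -
  have t1: "t > 1" using metallic_gt_1[OF n] by (simp add: t_def)
  \<comment> \<open>The value that \<open>\<bar>X - \<alpha> Y\<bar>\<close> takes for the
    \<open>j\<close>-th power. The bound \<open>K f^2 + D M f < 1\<close> obtained below is what
    rules out \<open>m \<le> M\<close>.\<close>
  define f where "f j = (1 / t) ^ j / \<bar>E\<bar>" for j :: nat
  have lim: "f \<longlonglongrightarrow> 0"
    unfolding f_def using t1 by (intro tendsto_divide_zero LIMSEQ_power_zero) auto
  have "(\<lambda>j. K * f j * f j + D * real M * f j) \<longlonglongrightarrow> K * 0 * 0 + D * real M * 0"
    by (intro tendsto_intros lim)
  then have "eventually (\<lambda>j. K * f j * f j + D * real M * f j < 1) sequentially"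
    by (intro order_tendstoD) auto
  moreover have "eventually (\<lambda>j. f j < 1) sequentially" using lim by (intro order_tendstoD) auto
  ultimately have "eventually (\<lambda>j. K * f j * f j + D * real M * f j < 1 \<and> f j < 1) sequentially"
    by eventually_elim simp
  then obtain j where j: "K * f j * f j + D * real M * f j < 1" "f j < 1"
    using eventually_happens by force
  obtain u v :: int where uv: "(real n - t) ^ j = of_int u - of_int v * t"
      "t ^ j = of_int u - of_int v * (real n - t)"
    using metallic_powers unfolding t_def by blast
  \<comment> \<open>The inverse of the integral change of variables, so that
    \<open>factor_transform\<close> returns the coefficients \<open>v\<close> and
    \<open>u\<close>.\<close>
  define X where "X = - (v * r + u * p)"
  define Y where "Y = - (v * s + u * q)"
  have XY: "X * q - Y * p = v" "Y * r - X * s = u"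
  proof -
    have "X * q - Y * p = v * (p * s - q * r)" "Y * r - X * s = u * (p * s - q * r)"
      by (simp_all add: X_def Y_def algebra_simps)
    then show "X * q - Y * p = v" "Y * r - X * s = u" using det by simp_all
  qed
  define d where "d = \<bar>of_int X - \<alpha> * of_int Y\<bar>"
  have "(of_int X - \<alpha> * of_int Y) * E = - (t' ^ j)"
    unfolding factor_transform XY using uv(1) by (simp add: t'_def mult.commute)
  then have "d * \<bar>E\<bar> = (1 / t) ^ j"
    unfolding d_def abs_mult[symmetric]
    using abs_metallic_conj[OF n] by (simp add: power_abs t'_def t_def)
  then have df: "d = f j" using denominators_nonzero by (simp add: f_def eq_divide_eq)
  then have d0: "d > 0" using t1 denominators_nonzero by (simp add: f_def)
  have "K * d * \<bar>of_int X - \<alpha>' * of_int Y\<bar> =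
      \<bar>((of_int X - \<alpha> * of_int Y) * E) * ((of_int X - \<alpha>' * of_int Y) * E')\<bar>"
    by (simp add: K_def d_def abs_mult)
  also have "\<dots> = \<bar>(t' * t) ^ j\<bar>"
  proof -
    have "t * of_int v - of_int u = - (t' ^ j)" "t' * of_int v - of_int u = - (t ^ j)"
      using uv by (simp_all add: t'_def mult.commute)
    then show ?thesis unfolding factor_transform XY by (simp add: power_mult_distrib)
  qed
  also have "\<dots> = 1" using metallic_mult_conj[of n] by (simp add: t'_def t_def mult.commute)
  finally have prod: "K * d * \<bar>of_int X - \<alpha>' * of_int Y\<bar> = 1" .
  define m where "m = nat \<bar>Y\<bar>"
  have m: "real m = \<bar>of_int Y\<bar>" by (simp add: m_def)
  have "1 \<le> K * d * (d + \<bar>\<alpha> - \<alpha>'\<bar> * real m)"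
    unfolding prod[symmetric] m d_def using conj_factor_le[of X Y] K_pos
    by (intro mult_left_mono) auto
  also have "\<dots> = K * d * d + (K * \<bar>\<alpha> - \<alpha>'\<bar>) * real m * d" by (simp add: algebra_simps)
  finally have "1 \<le> K * d * d + D * real m * d" unfolding diff_conj .
  then have "D * d * real M < D * d * real m" using j(1) unfolding df by (simp add: algebra_simps)
  moreover have "D * d > 0" using d0 by (simp add: D_def add_nonneg_pos)
  ultimately have mM: "m > M" by (simp only: mult_less_cancel_left_pos of_nat_less_iff)
  then have m0: "real m > 0" by simp
  have "K * d * (\<bar>\<alpha> - \<alpha>'\<bar> * real m) \<le> K * d * (\<bar>of_int X - \<alpha>' * of_int Y\<bar> + d)"
    unfolding m d_def using conj_factor_ge[of Y X] K_pos by (intro mult_left_mono) auto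
  also have "\<dots> = 1 + K * d * d" using prod by (simp add: algebra_simps)
  also have "\<dots> \<le> 1 + K * 1 * d"
    using j(2) K_pos d0 df by (intro add_left_mono mult_right_mono mult_left_mono) auto
  finally have "(K * \<bar>\<alpha> - \<alpha>'\<bar>) * real m * d \<le> 1 + K * d" by (simp add: algebra_simps)
  then have "D * real m * d \<le> 1 + K * d" unfolding diff_conj .
  moreover have "(D - K / real m) * (real m * d) = D * real m * d - K * d"
    using m0 by (simp add: field_simps)
  ultimately have "(D - K / real m) * (real m * d) \<le> 1" by simp
  then have "D - K / real m \<le> 1 / (real m * d)" using m0 d0 by (simp add: pos_le_divide_eq)
  also have "\<dots> \<le> 1 / (real m * dist_int (real m * \<alpha>))"
  proof -
    \<comment> \<open>\<open>Y\<close> may be negative, so the integer compared with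
      \<open>m \<alpha>\<close> is \<open>X\<close> with the sign of \<open>Y\<close>
      attached.\<close>
    have "dist_int (real m * \<alpha>) \<le> \<bar>real m * \<alpha> - of_int (sgn Y * X)\<bar>" by (rule dist_int_le)
    also have "\<dots> = d"
      by (cases "Y > 0"; cases "Y = 0") (use m m0 in \<open>auto simp: d_def sgn_if abs_minus_commute algebra_simps\<close>)
    finally have "dist_int (real m * \<alpha>) \<le> d" .
    moreover have "dist_int (real m * \<alpha>) > 0"
      using dist_int_pos irrational_nat_mult mobius_irrational mM by (metis gr_zeroI less_nat_zero_code)
    ultimately show ?thesis using m0 d0 by (intro divide_left_mono mult_left_mono mult_pos_pos) auto
  qed
  finally show ?thesis using mM by blast
qed

end

text \<open>Matrices of determinant \<open>1\<close> with first column \<open>(p, q)\<close> send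
  the metallic mean to a point at distance \<open>1 / (q E)\<close> from \<open>p / q\<close>, and
  adding \<open>N\<close> times the first column to the second enlarges \<open>E\<close>. All these
  images share the leading term \<open>sqrt (real n ^ 2 + 4)\<close>.\<close>

lemma lagrange_dense:
  assumes "n > 0" "a < b"
  obtains \<alpha> C where "a < \<alpha>" "\<alpha> < b" "\<alpha> \<notin> \<rat>" "C > 0"
    "\<And>m. m > 0 \<Longrightarrow> 1 / (real m * dist_int (real m * \<alpha>)) \<le> sqrt (real n ^ 2 + 4) + C / real m"
    "\<And>M. \<exists>m>M. 1 / (real m * dist_int (real m * \<alpha>)) \<ge> sqrt (real n ^ 2 + 4) - C / real m"
proof -
  obtain x where x: "x \<in> \<rat>" "a < x" "x < b" using Rats_dense_in_real assms(2) by blast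
  then obtain p q :: int where pq: "q > 0" "coprime p q" "x = of_int p / of_int q"
    by (metis Rats_cases')
  obtain s r0 where "s * p + r0 * q = 1" using bezout_int[of p q] pq(2) by (metis coprime_imp_gcd_eq_1)
  then have det0: "p * s - q * (-r0) = 1" by (simp add: algebra_simps)
  \<comment> \<open>The summand with \<open>s\<close> compensates a negative \<open>s\<close>, so
    that \<open>E\<close> exceeds \<open>1 / (x - a)\<close>.\<close>
  obtain N :: nat where N: "real N > 1 / (x - a) + \<bar>of_int s\<bar>" using reals_Archimedean2 by blast
  define r' where "r' = - r0 + p * int N"
  define s' where "s' = s + q * int N"
  have det: "p * s' - q * r' = 1" using det0 by (simp add: r'_def s'_def algebra_simps)
  let ?t = "metallic n"
  define E where "E = of_int q * ?t + of_int s'"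
  define \<alpha> where "\<alpha> = (of_int p * ?t + of_int r') / E"
  have t1: "?t > 1" using metallic_gt_1[OF assms(1)] .
  have "of_int q * ?t > 0" using t1 pq by simp
  moreover have "of_int q * real N \<ge> 1 * real N" using pq by (intro mult_right_mono) auto
  ultimately have EN: "E > 1 / (x - a)" unfolding E_def s'_def using N by simp
  have xa: "x - a > 0" using x by simp
  have E0: "E > 0" using EN xa by (meson divide_pos_pos less_trans zero_less_one)
  have "x - \<alpha> = of_int (p * s' - q * r') / (of_int q * E)"
    using pq E0 unfolding \<alpha>_def pq(3)
    by (simp add: field_simps) (simp add: E_def algebra_simps)
  then have diff: "x - \<alpha> = 1 / (of_int q * E)" using det by simp
  have "1 * E \<le> of_int q * E" using pq E0 by (intro mult_right_mono) auto
  then have "1 / (of_int q * E) \<le> 1 / E" using E0 by (intro divide_left_mono) auto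
  also have "1 / E < x - a" using EN xa E0 by (simp add: field_simps)
  finally have "a < \<alpha>" using diff by simp
  moreover have "x - \<alpha> > 0" unfolding diff using pq E0 by simp
  then have "\<alpha> < b" using x by simp
  ultimately show thesis
    using mobius_irrational[OF assms(1) det] K_pos[OF assms(1) det]
      approx_lower[OF assms(1) det] approx_upper[OF assms(1) det]
    unfolding E_def[symmetric] \<alpha>_def[symmetric] by (rule that)
qed

section \<open>Occurrences of short words in words with sparse ones\<close>

definition prefix_sum :: "(nat \<Rightarrow> nat) \<Rightarrow> nat \<Rightarrow> nat" where
  "prefix_sum s n = (\<Sum>i<n. s i)"

lemma prefix_sum_0 [simp]: "prefix_sum s 0 = 0"
  and prefix_sum_Suc [simp]: "prefix_sum s (Suc n) = prefix_sum s n + s n"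
  by (simp_all add: prefix_sum_def)

lemma prefix_sum_mono: "a \<le> b \<Longrightarrow> prefix_sum s a \<le> prefix_sum s b"
  unfolding prefix_sum_def by (rule sum_mono2) auto

lemma prefix_sum_diff: 
  assumes "a \<le> b"
  shows "prefix_sum s b = prefix_sum s a + (\<Sum>i\<in>{a..<b}. s i)"
proof -
  have "{..<b} = {..<a} \<union> {a..<b}" using assms by auto
  then show ?thesis unfolding prefix_sum_def by (metis finite_atLeastLessThan finite_lessThan
        ivl_disj_int_one(2) sum.union_disjoint)
qed

text \<open>A letter is \<open>1\<close> exactly when the next step of the rotation reaches an
  integer, so the sum telescopes to a floor.\<close>

lemma sturmian_word_prefix_sum:
  assumes "0 < \<alpha>" "\<alpha> < 1" "0 \<le> x" "x < 1"
  shows "int (prefix_sum (sturmian_word \<alpha> x) n) = \<lfloor>x + real n * \<alpha>\<rfloor>"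
proof (induction n)
  case 0
  show ?case using assms by (simp add: floor_eq_iff)
next
  case (Suc n)
  have f: "frac (1 - \<alpha>) = 1 - \<alpha>" using assms by (simp add: frac_eq)
  define y where "y = x + real n * \<alpha>"
  have "int (sturmian_word \<alpha> x n) = \<lfloor>y + \<alpha>\<rfloor> - \<lfloor>y\<rfloor>"
  proof (cases "frac y < 1 - \<alpha>")
    case True
    then have "\<lfloor>y + \<alpha>\<rfloor> = \<lfloor>y\<rfloor>" using assms unfolding frac_def by linarith
    then show ?thesis using True by (simp add: sturmian_word_def f y_def[symmetric])
  next
    case False
    then have "\<lfloor>y + \<alpha>\<rfloor> = \<lfloor>y\<rfloor> + 1" using assms unfolding frac_def by linarith
    then show ?thesis using False by (simp add: sturmian_word_def f y_def[symmetric])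
  qed
  then show ?case using Suc by (simp add: y_def algebra_simps)
qed

text \<open>A letter is now \<open>1\<close> exactly when an integer lies in
  \<open>[y, y + \<alpha>)\<close>. The ceiling counts these, just as the floor counts those in
  \<open>(y, y + \<alpha>]\<close>.\<close>

lemma sturmian_word_left_open_prefix_sum:
  assumes "0 < \<alpha>" "\<alpha> < 1"
  shows "int (prefix_sum (sturmian_word_left_open \<alpha> x) n) = \<lceil>x + real n * \<alpha>\<rceil> - \<lceil>x\<rceil>"
proof (induction n)
  case 0
  show ?case by simp
next
  case (Suc n)
  have f: "frac (1 - \<alpha>) = 1 - \<alpha>" using assms by (simp add: frac_eq)
  define y where "y = x + real n * \<alpha>"
  have "int (sturmian_word_left_open \<alpha> x n) = \<lceil>y + \<alpha>\<rceil> - \<lceil>y\<rceil>"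
  proof (cases "frac y \<in> {0<..1 - \<alpha>}")
    case True
    then have y: "of_int \<lfloor>y\<rfloor> < y" "y + \<alpha> \<le> of_int \<lfloor>y\<rfloor> + 1" by (auto simp: frac_def)
    have "\<lceil>y\<rceil> = \<lfloor>y\<rfloor> + 1" "\<lceil>y + \<alpha>\<rceil> = \<lfloor>y\<rfloor> + 1"
      using y assms by (simp_all add: ceiling_eq_iff)
    then have "\<lceil>y + \<alpha>\<rceil> = \<lceil>y\<rceil>" by simp
    then show ?thesis using True by (simp add: sturmian_word_left_open_def f y_def[symmetric])
  next
    case False
    then consider "y = of_int \<lfloor>y\<rfloor>" | "of_int \<lfloor>y\<rfloor> < y" "y + \<alpha> > of_int \<lfloor>y\<rfloor> + 1"
      unfolding frac_def by (auto simp: not_le) linarith+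
    then have "\<lceil>y + \<alpha>\<rceil> = \<lceil>y\<rceil> + 1"
    proof cases
      case 1
      then have "\<lceil>y\<rceil> = \<lfloor>y\<rfloor>" by (metis ceiling_of_int)
      moreover have "\<lceil>y + \<alpha>\<rceil> = \<lfloor>y\<rfloor> + 1" using 1 assms by (intro ceiling_unique) linarith+
      ultimately show ?thesis by simp
    next
      case 2
      have "\<lceil>y\<rceil> = \<lfloor>y\<rfloor> + 1" using 2 by (intro ceiling_unique) linarith+
      moreover have "\<lceil>y + \<alpha>\<rceil> = \<lfloor>y\<rfloor> + 2" using 2 assms by (intro ceiling_unique) linarith+
      ultimately show ?thesis by simp
    qed
    then show ?thesis using False by (simp add: sturmian_word_left_open_def f y_def[symmetric])
  qed
  then show ?case using Suc by (simp add: y_def algebra_simps)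
qed

text \<open>Weak inequalities at both ends cover both conventions for the half-open intervals.\<close>

lemma sturmian_words_coding:
  assumes "0 < \<alpha>" "\<alpha> < 1" "s \<in> sturmian_words \<alpha>"
  obtains x where "\<And>n. s n \<le> 1"
    "\<And>n. 0 \<le> x + real n * \<alpha> - real (prefix_sum s n)"
    "\<And>n. x + real n * \<alpha> - real (prefix_sum s n) \<le> 1"
proof -
  consider x where "0 \<le> x" "x < 1" "s = sturmian_word \<alpha> x"
    | x where "s = sturmian_word_left_open \<alpha> x"
    using assms(3) unfolding sturmian_words_def by auto
  then show thesis
  proof cases
    case 1
    have 2: "real (prefix_sum s n) = of_int \<lfloor>x + real n * \<alpha>\<rfloor>" for n
      using sturmian_word_prefix_sum[OF assms(1,2) 1(1,2), of n] unfolding 1(3)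
      by (metis of_int_of_nat_eq)
    show thesis
    proof (rule that[of x])
      show "s n \<le> 1" for n by (simp add: 1(3) sturmian_word_def)
      show "0 \<le> x + real n * \<alpha> - real (prefix_sum s n)" for n unfolding 2 by linarith
      show "x + real n * \<alpha> - real (prefix_sum s n) \<le> 1" for n unfolding 2 by linarith
    qed
  next
    case (2 x)
    have 3: "real (prefix_sum s n) = of_int \<lceil>x + real n * \<alpha>\<rceil> - of_int \<lceil>x\<rceil>" for n
      using sturmian_word_left_open_prefix_sum[OF assms(1,2), of x n] unfolding 2
      by (metis of_int_of_nat_eq of_int_diff)
    show thesis
    \<comment> \<open>Subtracting the ceiling leaves values in \<open>(-1, 0]\<close>; the added
      \<open>1\<close> moves them into \<open>(0, 1]\<close>.\<close>
    proof (rule that[of "x + 1 - of_int \<lceil>x\<rceil>"])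
      show "s n \<le> 1" for n by (simp add: 2 sturmian_word_left_open_def)
      show "0 \<le> x + 1 - of_int \<lceil>x\<rceil> + real n * \<alpha> - real (prefix_sum s n)" for n
        unfolding 3 by linarith
      show "x + 1 - of_int \<lceil>x\<rceil> + real n * \<alpha> - real (prefix_sum s n) \<le> 1" for n
        unfolding 3 by linarith
    qed
  qed
qed

text \<open>Two ones closer than \<open>K\<close> would raise the prefix sum by \<open>2\<close>
  within \<open>K\<close> letters, while the rotation advances by less than \<open>1\<close> and the
  difference of the two stays in an interval of length \<open>1\<close>.\<close>

lemma coding_sparse:
  assumes "0 < \<alpha>" "real K * \<alpha> < 1"
    and "\<And>n. 0 \<le> x + real n * \<alpha> - real (prefix_sum s n)"
    and "\<And>n. x + real n * \<alpha> - real (prefix_sum s n) \<le> 1"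
    and "s i = 1" "s j = 1" "i < j"
  shows "i + K \<le> j"
proof (rule ccontr)
  assume "\<not> i + K \<le> j"
  then have le: "Suc j - i \<le> K" by simp
  have "real (Suc j - i) * \<alpha> \<le> real K * \<alpha>" using le assms(1) by (intro mult_right_mono) auto
  then have lt: "(real (Suc j) - real i) * \<alpha> < 1" using assms(2,7) by (simp add: of_nat_diff)
  have "prefix_sum s (Suc j) = prefix_sum s j + 1" using assms by simp
  moreover have "prefix_sum s j \<ge> prefix_sum s (Suc i)" using assms(7) by (intro prefix_sum_mono) auto
  ultimately have "real (prefix_sum s (Suc j)) \<ge> real (prefix_sum s i) + 2" using assms(5) by simp
  with assms(3)[of "Suc j"] assms(4)[of i] lt show False by (simp add: algebra_simps del: prefix_sum_Suc)
qed

section \<open>Occurrence counts as differences of prefix sums\<close>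

lemma occurrences_block:
  "occurrences w (map s [i..<i + m]) =
     card {j. j + length w \<le> m \<and> (\<forall>a<length w. s (i + j + a) = w ! a)}"
proof -
  have "take (length w) (drop j (map s [i..<i + m])) = w \<longleftrightarrow> (\<forall>a<length w. s (i + j + a) = w ! a)"
    if "j + length w \<le> m" for j
    using that by (auto simp: list_eq_iff_nth_eq nth_append add.assoc)
  then show ?thesis unfolding occurrences_def by (intro arg_cong[where f = card]) auto
qed

text \<open>With ones at least \<open>k\<close> apart, these words and the words of zeros are the
  only factors of length at most \<open>k\<close>.\<close>

definition one_at :: "nat \<Rightarrow> nat \<Rightarrow> nat list" where
  "one_at a b = replicate a 0 @ 1 # replicate b 0"

lemma length_one_at [simp]: "length (one_at a b) = a + b + 1"
  by (simp add: one_at_def)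

lemma nth_one_at: "c < a + b + 1 \<Longrightarrow> one_at a b ! c = (if c = a then 1 else 0)"
  by (auto simp: one_at_def nth_append nth_Cons split: nat.splits)

locale sparse_word =
  fixes s :: "nat \<Rightarrow> nat" and k :: nat
  assumes le_1: "s n \<le> 1"
    and sparse: "s i = 1 \<Longrightarrow> s j = 1 \<Longrightarrow> i < j \<Longrightarrow> i + k \<le> j"
begin

lemma eq_0: "s n \<noteq> 1 \<Longrightarrow> s n = 0"
  using le_1[of n] by linarith

text \<open>The condition \<open>a + b < k\<close> leaves no room for a second one, so the place of
  the one determines the whole window.\<close>

lemma window_one_at:
  assumes "a + b < k"
  shows "(\<forall>c<a + b + 1. s (i + c) = one_at a b ! c) \<longleftrightarrow> s (i + a) = 1"
proof
  assume "\<forall>c<a + b + 1. s (i + c) = one_at a b ! c"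
  then have "s (i + a) = one_at a b ! a" by simp
  then show "s (i + a) = 1" by (simp add: nth_one_at)
next
  assume 1: "s (i + a) = 1"
  show "\<forall>c<a + b + 1. s (i + c) = one_at a b ! c"
  proof (intro allI impI)
    fix c assume c: "c < a + b + 1"
    have "s (i + c) = 0" if "c \<noteq> a"
    proof (rule eq_0, rule notI)
      assume "s (i + c) = 1"
      then show False
        using sparse[OF 1, of "i + c"] sparse[of "i + c" "i + a"] 1 c assms that
        by (cases "c < a") auto
    qed
    then show "s (i + c) = one_at a b ! c" using 1 c by (simp add: nth_one_at)
  qed
qed

lemma sum_eq_card: "finite A \<Longrightarrow> (\<Sum>i\<in>A. s i) = card {i \<in> A. s i = 1}"
proof -
  assume "finite A"
  moreover have "(\<Sum>i\<in>A. s i) = (\<Sum>i\<in>A. if s i = 1 then 1 else 0)"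
    by (intro sum.cong) (auto simp: eq_0)
  ultimately show ?thesis by (simp add: sum.If_cases Int_def)
qed

text \<open>The place \<open>i + j + a\<close> of the one runs through the block shortened by
  \<open>a\<close> letters on the left and \<open>b\<close> on the right.\<close>

lemma card_ones:
  assumes "a + b + 1 \<le> m"
  shows "card {j. j + (a + b + 1) \<le> m \<and> s (i + j + a) = 1} =
    prefix_sum s (i + m - b) - prefix_sum s (i + a)"
proof -
  have "bij_betw (\<lambda>j. i + j + a) {j. j + (a + b + 1) \<le> m \<and> s (i + j + a) = 1}
      {h \<in> {i + a..<i + m - b}. s h = 1}"
  proof (rule bij_betwI[where g = "\<lambda>h. h - i - a"])
  qed (use assms in auto)
  then have "card {j. j + (a + b + 1) \<le> m \<and> s (i + j + a) = 1} =
      card {h \<in> {i + a..<i + m - b}. s h = 1}" by (rule bij_betw_same_card)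
  also have "\<dots> = (\<Sum>h\<in>{i + a..<i + m - b}. s h)" by (rule sum_eq_card[symmetric]) simp
  also have "\<dots> = prefix_sum s (i + m - b) - prefix_sum s (i + a)"
    using prefix_sum_diff[of "i + a" "i + m - b" s] assms by simp
  finally show ?thesis .
qed

lemma occurrences_one_at:
  assumes "a + b < k" "k \<le> m"
  shows "occurrences (one_at a b) (map s [i..<i + m]) =
    prefix_sum s (i + m - b) - prefix_sum s (i + a)"
  unfolding occurrences_block length_one_at window_one_at[OF assms(1)]
  using card_ones[of a b m i] assms by simp

text \<open>Each of the \<open>m + 1 - l\<close> windows consists of zeros or has a unique one.
  Sorting the latter by the place \<open>a\<close> of the one gives disjoint classes, which
  \<open>card_ones\<close> counts.\<close>

lemma occurrences_zeros:
  assumes "0 < l" "l \<le> k" "k \<le> m"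
  shows "occurrences (replicate l 0) (map s [i..<i + m]) + 
     (\<Sum>a<l. prefix_sum s (i + m - (l - 1 - a)) - prefix_sum s (i + a)) = m + 1 - l"
proof -
  define B where "B a = {j. j + l \<le> m \<and> s (i + j + a) = 1}" for a
  define Z where "Z = {j. j + l \<le> m \<and> (\<forall>a<l. s (i + j + a) = 0)}"
  have fin: "finite (B a)" for a
    by (rule finite_subset[of _ "{..m}"]) (auto simp: B_def)
  have finZ: "finite Z"
    by (rule finite_subset[of _ "{..m}"]) (auto simp: Z_def)
  have cB: "card (B a) = prefix_sum s (i + m - (l - 1 - a)) - prefix_sum s (i + a)" if "a < l" for a
    using card_ones[of a "l - 1 - a" m i] that assms by (simp add: B_def)
  have disj: "B a \<inter> B b = {}" if "a < l" "b < l" "a \<noteq> b" for a b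
  proof (rule ccontr)
    assume "B a \<inter> B b \<noteq> {}"
    then obtain j where "s (i + j + a) = 1" "s (i + j + b) = 1" by (auto simp: B_def)
    then show False
      using sparse[of "i + j + a" "i + j + b"] sparse[of "i + j + b" "i + j + a"] that assms
      by (cases "a < b") auto
  qed
  have "card (\<Union>a\<in>{..<l}. B a) = (\<Sum>a<l. card (B a))"
    by (rule card_UN_disjoint) (use fin disj in auto)
  also have "\<dots> = (\<Sum>a<l. prefix_sum s (i + m - (l - 1 - a)) - prefix_sum s (i + a))"
    by (rule sum.cong) (use cB in auto)
  finally have cU: "card (\<Union>a\<in>{..<l}. B a) = \<dots>" .
  have "Z \<union> (\<Union>a\<in>{..<l}. B a) = {j. j + l \<le> m}"
    using eq_0 by (auto simp: Z_def B_def)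
  also have "\<dots> = {..<m + 1 - l}" by auto
  finally have U: "Z \<union> (\<Union>a\<in>{..<l}. B a) = {..<m + 1 - l}" .
  have "card Z + card (\<Union>a\<in>{..<l}. B a) = card (Z \<union> (\<Union>a\<in>{..<l}. B a))"
    by (rule card_Un_disjoint[symmetric]) (use fin finZ in \<open>auto simp: Z_def B_def\<close>)
  moreover have "occurrences (replicate l 0) (map s [i..<i + m]) = card Z"
    unfolding occurrences_block Z_def by (intro arg_cong[where f = card]) auto
  ultimately show ?thesis unfolding cU U by simp
qed

lemma occurrences_cases:
  assumes "length w \<le> k" "w \<noteq> []"
  shows "(\<forall>i. occurrences w (map s [i..<i + m]) = 0) \<or> w = replicate (length w) 0 \<or>
    (\<exists>a b. w = one_at a b)"
proof (rule ccontr)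
  assume neg: "\<not> ?thesis"
  then obtain i where "occurrences w (map s [i..<i + m]) \<noteq> 0" by blast
  then have "{j. j + length w \<le> m \<and> (\<forall>a<length w. s (i + j + a) = w ! a)} \<noteq> {}"
    unfolding occurrences_block by (metis card.empty)
  then obtain j where j: "\<forall>c<length w. s (i + j + c) = w ! c" by blast
  show False
  proof (cases "\<exists>a<length w. s (i + j + a) = 1")
    case True
    then obtain a where a: "a < length w" "s (i + j + a) = 1" by blast
    define b where "b = length w - 1 - a"
    have lw: "length w = a + b + 1" using a by (simp add: b_def)
    have "w = one_at a b"
      using window_one_at[of a b "i + j"] a j assms lw by (intro nth_equalityI) auto
    then show False using neg by blast
  next
    case False
    then have "w = replicate (length w) 0" using j eq_0 by (intro nth_equalityI) (simp, metis nth_replicate length_replicate)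
    then show False using neg by blast
  qed
qed

text \<open>The differences on the right are the counts of \<open>one_at a b\<close>. By
  \<open>occurrences_zeros\<close> they also determine the counts of words of zeros, and no other
  short word occurs.\<close>

lemma k_abelian_equiv_blocks_iff:
  assumes "k \<le> m"
  shows "k_abelian_equiv k (map s [i..<i + m]) (map s [j..<j + m]) \<longleftrightarrow>
    (\<forall>a b. a + b < k \<longrightarrow> prefix_sum s (i + m - b) - prefix_sum s (i + a) =
                          prefix_sum s (j + m - b) - prefix_sum s (j + a))"
    (is "?L \<longleftrightarrow> ?R")
proof
  assume L: ?L
  show ?R
  proof (intro allI impI)
    fix a b assume ab: "a + b < k"
    have "one_at a b \<noteq> []" "length (one_at a b) \<le> k" using ab by (auto simp: one_at_def)
    then have "occurrences (one_at a b) (map s [i..<i + m]) = occurrences (one_at a b) (map s [j..<j + m])"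
      using L unfolding k_abelian_equiv_def by blast
    then show "prefix_sum s (i + m - b) - prefix_sum s (i + a) =
        prefix_sum s (j + m - b) - prefix_sum s (j + a)"
      unfolding occurrences_one_at[OF ab assms] .
  qed
next
  assume R: ?R
  show ?L unfolding k_abelian_equiv_def
  proof (intro allI impI)
    fix w :: "nat list" assume w: "w \<noteq> [] \<and> length w \<le> k"
    consider "\<forall>i. occurrences w (map s [i..<i + m]) = 0" | "w = replicate (length w) 0"
      | a b where "w = one_at a b"
      using occurrences_cases w by blast
    then show "occurrences w (map s [i..<i + m]) = occurrences w (map s [j..<j + m])"
    proof cases
      case 1 then show ?thesis by simp
    next
      case 2
      define l where "l = length w"
      have l: "0 < l" "l \<le> k" using w by (auto simp: l_def)
      have "(\<Sum>a<l. prefix_sum s (i + m - (l - 1 - a)) - prefix_sum s (i + a)) =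
          (\<Sum>a<l. prefix_sum s (j + m - (l - 1 - a)) - prefix_sum s (j + a))"
      proof (rule sum.cong)
        fix a assume "a \<in> {..<l}"
        then have "a + (l - 1 - a) < k" using l by auto
        then show "prefix_sum s (i + m - (l - 1 - a)) - prefix_sum s (i + a) =
            prefix_sum s (j + m - (l - 1 - a)) - prefix_sum s (j + a)" using R by blast
      qed simp
      then have "occurrences (replicate l 0) (map s [i..<i + m]) =
          occurrences (replicate l 0) (map s [j..<j + m])"
        using occurrences_zeros[OF l assms, of i] occurrences_zeros[OF l assms, of j] by simp
      then show ?thesis using 2 l_def by simp
    next
      case 3
      then have ab: "a + b < k" using w by simp
      show ?thesis using R ab unfolding 3 occurrences_one_at[OF ab assms] by blast
    qed
  qed
qed

end

section \<open>Powers as runs of equivalent blocks\<close>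

lemma blocks_of_concat:
  assumes "concat us = map s [i..<i + length us * m]" "\<forall>u\<in>set us. length u = m" "j < length us"
  shows "us ! j = map s [i + j * m..<i + j * m + m]"
  using assms
proof (induction us arbitrary: i j)
  case Nil
  then show ?case by simp
next
  case (Cons u us)
  have lu: "length u = m" using Cons.prems by simp
  have "[i..<i + length (u # us) * m] = [i..<i + m] @ [i + m..<(i + m) + length us * m]"
    using upt_add_eq_append[of i "i + m" "length us * m"] by (simp add: add.assoc)
  then have eq: "u @ concat us = map s [i..<i + m] @ map s [i + m..<(i + m) + length us * m]"
    using Cons.prems(1) by simp
  then have u: "u = map s [i..<i + m]" and us: "concat us = map s [i + m..<(i + m) + length us * m]"
    using lu by (simp_all add: append_eq_append_conv)
  show ?case
  proof (cases j)
    case 0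
    then show ?thesis using u by simp
  next
    case (Suc j')
    then show ?thesis using Cons.IH[OF us, of j'] Cons.prems by (simp add: algebra_simps)
  qed
qed

lemma concat_of_blocks:
  "concat (map (\<lambda>j. map s [i + j * m..<i + j * m + m]) [0..<n]) = map s [i..<i + n * m]"
proof (induction n)
  case 0
  then show ?case by simp
next
  case (Suc n)
  have "[i..<i + Suc n * m] = [i..<i + n * m] @ [i + n * m..<i + n * m + m]"
    using upt_add_eq_append[of i "i + n * m" m] by (simp add: algebra_simps)
  then show ?case using Suc by simp
qed

lemma k_abelian_power_occurs_iff:
  "(\<exists>w. occurs_in w s \<and> k_abelian_power k m n w) \<longleftrightarrow>
   (\<exists>i. \<forall>j<n. \<forall>j'<n. k_abelian_equiv k (map s [i + j * m..<i + j * m + m])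
                                      (map s [i + j' * m..<i + j' * m + m]))"
    (is "?L \<longleftrightarrow> ?R")
proof
  assume ?L
  then obtain w i us where w: "w = map s [i..<i + length w]" "w = concat us" "length us = n"
      "\<forall>u\<in>set us. length u = m" "\<forall>u\<in>set us. \<forall>v\<in>set us. k_abelian_equiv k u v"
    unfolding occurs_in_def k_abelian_power_def by blast
  have "length w = n * m"
    using w(2-4) by (simp add: length_concat sum_list_triv map_cong[of us us length "\<lambda>_. m"])
  then have c: "concat us = map s [i..<i + length us * m]" using w by simp
  show ?R
  proof (intro exI allI impI)
    fix j j' assume "j < n" "j' < n"
    then show "k_abelian_equiv k (map s [i + j * m..<i + j * m + m]) (map s [i + j' * m..<i + j' * m + m])"
      using blocks_of_concat[OF c w(4)] w(3,5) by (metis nth_mem)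
  qed
next
  assume ?R
  then obtain i where i: "\<forall>j<n. \<forall>j'<n. k_abelian_equiv k (map s [i + j * m..<i + j * m + m])
                                      (map s [i + j' * m..<i + j' * m + m])" by blast
  define us where "us = map (\<lambda>j. map s [i + j * m..<i + j * m + m]) [0..<n]"
  have "k_abelian_power k m n (concat us)"
    unfolding k_abelian_power_def by (rule exI[of _ us]) (use i in \<open>auto simp: us_def\<close>)
  moreover have "occurs_in (concat us) s"
    unfolding occurs_in_def us_def concat_of_blocks by auto
  ultimately show ?L by blast
qed

section \<open>Powers in Sturmian words of small slope\<close>

text \<open>Within distance \<open>k - 1\<close> the word looks the same around the first and the
  last inner block boundary, which lie \<open>n - 2\<close> periods apart. Hence the two
  corresponding points of the rotation, at distance \<open>\<bar>H\<bar>\<close>, lie in a common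
  interval of length at most \<open>L\<close>.\<close>

lemma k_abelian_power_exponent_le:
  fixes \<alpha> :: real
  assumes "k > 0" "0 < \<alpha>" "(2 * real k - 1) * \<alpha> < 1" "\<alpha> \<notin> \<rat>" "k \<le> m"
    and "s \<in> sturmian_words \<alpha>" "occurs_in w s" "k_abelian_power k m n w"
  shows "real n \<le> (1 - (2 * real k - 2) * \<alpha>) / dist_int (real m * \<alpha>) + 2"
proof -
  define P where "P = prefix_sum s"
  have ka: "real k * \<alpha> \<le> (2 * real k - 1) * \<alpha>"
    using assms by (intro mult_right_mono) auto
  have "1 * \<alpha> \<le> real k * \<alpha>" using assms by (intro mult_right_mono) auto
  then have a1: "\<alpha> < 1" using ka assms(3) by linarith
  have ka1: "real k * \<alpha> < 1" using ka assms(3) by linarith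
  obtain x where x: "\<And>n. s n \<le> 1" "\<And>n. 0 \<le> x + real n * \<alpha> - real (P n)"
    "\<And>n. x + real n * \<alpha> - real (P n) \<le> 1"
    using sturmian_words_coding[OF assms(2) a1 assms(6)] unfolding P_def by blast
  interpret sparse_word s k
  proof
    show "s n \<le> 1" for n by (rule x)
    show "i + k \<le> j" if "s i = 1" "s j = 1" "i < j" for i j
      by (rule coding_sparse[OF assms(2) ka1 x(2,3)[unfolded P_def] that])
  qed
  define d where "d = dist_int (real m * \<alpha>)"
  have d0: "d > 0"
    unfolding d_def using assms by (intro dist_int_pos irrational_nat_mult) auto
  define L where "L = 1 - (2 * real k - 2) * \<alpha>"
  have L: "\<alpha> \<le> L" using assms(3) by (simp add: L_def algebra_simps)
  obtain i where i: "\<And>j j'. j < n \<Longrightarrow> j' < n \<Longrightarrow>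
      k_abelian_equiv k (map s [i + j * m..<i + j * m + m]) (map s [i + j' * m..<i + j' * m + m])"
    using k_abelian_power_occurs_iff[of s k m n] assms(7,8) by blast
  have cnt: "real (P (i + j * m + m - b)) - real (P (i + j * m + a)) = real (P (i + m - b)) - real (P (i + a))"
    if "j < n" "a + b < k" for j a b
  proof -
    have "P (i + j * m + m - b) - P (i + j * m + a) = P (i + 0 * m + m - b) - P (i + 0 * m + a)"
      using i[of j 0] that k_abelian_equiv_blocks_iff[OF assms(5)] unfolding P_def by simp
    moreover have "P (i + j * m + a) \<le> P (i + j * m + m - b)" "P (i + a) \<le> P (i + m - b)"
      unfolding P_def using that assms(5) by (intro prefix_sum_mono; simp)+
    ultimately show ?thesis by (simp add: of_nat_diff[symmetric] del: of_nat_diff)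
  qed
  define c where "c = real (P (i + m)) - real (P i)"
  have step: "real (P (i + j * m)) = real (P i) + real j * c" if "j \<le> n" for j
    using that
  proof (induction j)
    case (Suc j)
    then show ?case using cnt[of j 0 0] assms(1) by (simp add: c_def algebra_simps)
  qed simp
  show ?thesis
  \<comment> \<open>With at most two blocks there are no two inner boundaries to compare; the
    summand \<open>2\<close> of the bound covers this case.\<close>
  proof (cases "n \<le> 2")
    case True
    have "L / d \<ge> 0" using L assms d0 by simp
    then show ?thesis using True unfolding L_def d_def by linarith
  next
    case False
    \<comment> \<open>The left end of the window of radius \<open>k - 1\<close> about the first
      inner boundary \<open>i + m\<close>. In it \<open>e\<close> counts the ones, \<open>R\<close>
      is the point of the rotation at \<open>z\<close>, and \<open>H\<close> is the drift up to the
      last inner boundary.\<close>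
    define z where "z = i + m - (k - 1)"
    define e where "e j = real (P (z + j)) - real (P z)" for j
    define H where "H = (real n - 2) * (real m * \<alpha> - c)"
    define R where "R = x + real z * \<alpha> - real (P z)"
    \<comment> \<open>The left half of the window compares the ends of blocks \<open>0\<close> and
      \<open>n - 2\<close>, the right half the beginnings of blocks \<open>1\<close> and
      \<open>n - 1\<close>.\<close>
    have shift: "real (P (z + j + (n - 2) * m)) = real (P (z + j)) + real (n - 2) * c"
      if "j \<le> 2 * k - 2" for j
    proof (cases "j \<le> k - 1")
      case True
      define b where "b = k - 1 - j"
      have zb: "z + j = i + m - b" "b < k" "b \<le> m" using True assms(1,5) by (auto simp: z_def b_def)
      have "z + j + (n - 2) * m = i + (n - 2) * m + m - b" using zb by simp
      then have "real (P (z + j + (n - 2) * m)) = real (P (i + (n - 2) * m)) + real (P (i + m - b)) - real (P i)"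
        using cnt[of "n - 2" 0 b] zb False by simp
      then show ?thesis using step[of "n - 2"] zb False by simp
    next
      case False2: False
      define a where "a = j - (k - 1)"
      have za: "z + j = i + m + a" "a < k" using False2 that assms(1,5) by (auto simp: z_def a_def)
      have "m + (n - 2) * m = (n - 1) * m" 
        using False by (cases n) (auto simp: Suc_diff_Suc simp flip: mult_Suc)
      then have 1: "z + j + (n - 2) * m = i + (n - 1) * m + a" using za(1) by simp
      have 2: "real (P (i + (n - 1) * m + a)) =
          real (P (i + (n - 1) * m + m)) - real (P (i + m)) + real (P (i + a))"
        using cnt[of "n - 1" a 0] za False by simp
      have last: "i + (n - 1) * m + m = i + n * m" using False by (cases n) auto
      have 3: "real (P (i + (n - 1) * m + m)) = real (P i) + real n * c"
        unfolding last using step[of n] by simp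
      have 4: "real (P (z + j)) = real (P (i + 1 * m + m)) - real (P (i + m)) + real (P (i + a))"
        using cnt[of 1 a 0] za False by simp
      have second: "i + 1 * m + m = i + 2 * m" by simp
      have 5: "real (P (i + 1 * m + m)) = real (P i) + 2 * c"
        unfolding second using step[of 2] False by simp
      have "real (n - 2) * c = real n * c - 2 * c" using False by (simp add: of_nat_diff left_diff_distrib)
      then show ?thesis using 1 2 3 4 5 by simp
    qed
    have in1: "0 \<le> R + real j * \<alpha> - e j" "R + real j * \<alpha> - e j \<le> 1" for j
      using x(2,3)[of "z + j"] by (simp_all add: R_def e_def algebra_simps)
    have in2: "0 \<le> R + real j * \<alpha> - e j + H" "R + real j * \<alpha> - e j + H \<le> 1" if "j \<le> 2 * k - 2" for j
    proof -
      have n2: "real (n - 2) = real n - 2" using False by (simp add: of_nat_diff)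
      have "x + real (z + j + (n - 2) * m) * \<alpha> - real (P (z + j + (n - 2) * m)) = R + real j * \<alpha> - e j + H"
        unfolding shift[OF that] of_nat_add of_nat_mult n2 by (simp add: R_def e_def H_def algebra_simps)
      then show "0 \<le> R + real j * \<alpha> - e j + H" "R + real j * \<alpha> - e j + H \<le> 1"
        using x(2,3)[of "z + j + (n - 2) * m"] by simp_all
    qed
    have e0: "e 0 = 0" by (simp add: e_def)
    have "\<bar>H\<bar> \<le> L"
    proof (cases "e (2 * k - 2) = 0")
      case True
      \<comment> \<open>Without a one in the window, \<open>R\<close> and \<open>R + H\<close> both
        lie in \<open>[0, 1 - (2k - 2)\<alpha>]\<close>.\<close>
      have "real (2 * k - 2) = 2 * real k - 2" using assms(1) by (simp add: of_nat_diff)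
      then show ?thesis
        using in1[of 0] in2[of 0] in1[of "2 * k - 2"] in2[of "2 * k - 2"] True e0 by (simp add: L_def)
    next
      case ne: False
      have ex: "\<exists>j. j \<le> 2 * k - 2 \<and> e j \<noteq> 0" using ne by blast
      \<comment> \<open>The first one of the window is the letter at \<open>z + j\<close> with
        \<open>j = l - 1\<close>. Hence \<open>R + j \<alpha>\<close> and its translate by
        \<open>H\<close> both lie in \<open>[1 - \<alpha>, 1]\<close>.\<close>
      define l where "l = (LEAST j. j \<le> 2 * k - 2 \<and> e j \<noteq> 0)"
      have l: "l \<le> 2 * k - 2" "e l \<noteq> 0" using LeastI_ex[OF ex] by (auto simp: l_def)
      have "l \<noteq> 0" by (metis l(2) e0)
      then obtain j where j: "l = Suc j" using not0_implies_Suc by blast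
      have "\<not> (j \<le> 2 * k - 2 \<and> e j \<noteq> 0)"
        by (rule not_less_Least) (simp add: l_def[symmetric] j)
      then have ej: "e j = 0" using l(1) j by simp
      have "P z \<le> P (z + l)" unfolding P_def by (rule prefix_sum_mono) simp
      moreover have "P z \<noteq> P (z + l)" using l(2) by (auto simp: e_def)
      ultimately have "P z + 1 \<le> P (z + l)" by linarith
      then have el: "e l \<ge> 1" unfolding e_def by linarith
      have "real l * \<alpha> = real j * \<alpha> + \<alpha>" unfolding j by (simp add: algebra_simps)
      then have "\<bar>H\<bar> \<le> \<alpha>"
        using in1[of j] in2[of j] in1[of l] in2[of l] ej el l(1) j by simp
      then show ?thesis using L by simp
    qed
    moreover have "d \<le> \<bar>real m * \<alpha> - c\<bar>"
      using dist_int_le[of "real m * \<alpha>" "int (P (i + m)) - int (P i)"] by (simp add: d_def c_def)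
    then have "(real n - 2) * d \<le> \<bar>H\<bar>"
      using False d0 unfolding H_def abs_mult by (intro mult_mono) auto
    ultimately have "(real n - 2) * d \<le> L" by simp
    then have "real n - 2 \<le> L / d" using d0 by (simp add: pos_le_divide_eq)
    then show ?thesis unfolding L_def d_def by simp
  qed
qed

text \<open>The starting point is chosen so that the points from which the blocks start, reduced modulo
  \<open>1\<close>, move across the longest gap of the multiples \<open>j\<alpha>\<close>, \<open>\<bar>j\<bar> < k\<close>, without leaving it.\<close>

lemma k_abelian_power_exists:
  fixes \<alpha> :: real
  assumes "k > 0" "0 < \<alpha>" "(2 * real k - 1) * \<alpha> < 1" "\<alpha> \<notin> \<rat>" "k \<le> m"
  obtains n s w where "real n \<ge> (1 - (2 * real k - 2) * \<alpha>) / dist_int (real m * \<alpha>) - 1"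
    "s \<in> sturmian_words \<alpha>" "occurs_in w s" "k_abelian_power k m n w"
proof -
  define d where "d = dist_int (real m * \<alpha>)"
  have d0: "d > 0"
    unfolding d_def using assms by (intro dist_int_pos irrational_nat_mult) auto
  define L where "L = 1 - (2 * real k - 2) * \<alpha>"
  have "\<alpha> \<le> L" using assms(3) by (simp add: L_def algebra_simps)
  then have L0: "L > 0" using assms by simp
  have ka: "real k * \<alpha> \<le> (2 * real k - 1) * \<alpha>"
    using assms by (intro mult_right_mono) auto
  have "1 * \<alpha> \<le> real k * \<alpha>" using assms by (intro mult_right_mono) auto
  then have a1: "\<alpha> < 1" using ka assms(3) by linarith
  have ka1: "real k * \<alpha> < 1" using ka assms(3) by linarith
  \<comment> \<open>The largest integer strictly below \<open>L / d\<close>; strictness keeps all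
    \<open>n + 1\<close> block boundaries in a half-open gap of length \<open>L\<close>.\<close>
  define n where "n = nat (\<lceil>L / d\<rceil> - 1)"
  have "L / d > 0" using L0 d0 by simp
  then have n: "real n \<ge> L / d - 1" "real n < L / d" unfolding n_def by linarith+
  then have nd: "real n * d < L" using d0 by (simp add: pos_less_divide_eq)
  define c where "c = round (real m * \<alpha>)"
  define h where "h = real m * \<alpha> - of_int c"
  have hd: "\<bar>h\<bar> = d" by (simp add: h_def c_def d_def dist_int_def)
  \<comment> \<open>The boundaries drift by \<open>h\<close> per block. The start is the left end of
    the gap if the drift goes right; otherwise it lies \<open>n d\<close> further right, so that the
    drift ends at the left end.\<close>
  define x where "x = (real k - 1) * \<alpha> + (if h < 0 then real n * d else 0)"
  have k1: "(real k - 1) * \<alpha> \<ge> 0" using assms by simp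
  have nd0: "real n * d \<ge> 0" using d0 by simp
  have "(real k - 1) * \<alpha> + L \<le> 1" using k1 by (simp add: L_def algebra_simps)
  then have x01: "0 \<le> x" "x < 1" using k1 nd nd0 L0 by (auto simp: x_def)
  define s where "s = sturmian_word \<alpha> x"
  have pos: "(real k - 1) * \<alpha> \<le> x + real t * h" "x + real t * h < (real k - 1) * \<alpha> + L" if "t \<le> n" for t
  proof -
    have "real t * d \<le> real n * d" using that d0 by (intro mult_right_mono) auto
    moreover have "real t * d \<ge> 0" using d0 by simp
    moreover have "real t * h = (if h < 0 then - (real t * d) else real t * d)"
      using hd by auto
    ultimately show "(real k - 1) * \<alpha> \<le> x + real t * h" "x + real t * h < (real k - 1) * \<alpha> + L"
      using nd unfolding x_def by (simp_all split: if_split)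
  qed
  \<comment> \<open>Positions closer than \<open>k\<close> to the boundary \<open>t m\<close>
    displace the point by at most \<open>(k - 1)\<alpha>\<close>, and the gap keeps this margin from
    both neighbouring integers. So the floor is constant there.\<close>
  have P: "int (prefix_sum s j) = int t * c" if "t \<le> n" "\<bar>int j - int (t * m)\<bar> < int k" for t j
  proof -
    have "\<bar>real_of_int (int j - int (t * m))\<bar> \<le> real k - 1" using that(2) by linarith
    then have "\<bar>(real j - real t * real m) * \<alpha>\<bar> \<le> (real k - 1) * \<alpha>"
      unfolding abs_mult using assms(2) by (intro mult_mono) auto
    moreover have "real j * \<alpha> = (real j - real t * real m) * \<alpha> + real t * h + real t * of_int c"
      by (simp add: h_def algebra_simps)
    moreover have "2 * ((real k - 1) * \<alpha>) + L = 1" by (simp add: L_def algebra_simps)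
    ultimately have "of_int (int t * c) \<le> x + real j * \<alpha>" "x + real j * \<alpha> < of_int (int t * c) + 1"
      using pos[OF that(1)] by (simp_all add: abs_le_iff)
    then have "\<lfloor>x + real j * \<alpha>\<rfloor> = int t * c" by (simp add: floor_eq_iff)
    then show ?thesis unfolding s_def sturmian_word_prefix_sum[OF assms(2) a1 x01] .
  qed
  have sw: "s \<in> sturmian_words \<alpha>" unfolding s_def sturmian_words_def using x01 by auto
  obtain y where y: "\<And>n. s n \<le> 1" "\<And>n. 0 \<le> y + real n * \<alpha> - real (prefix_sum s n)"
    "\<And>n. y + real n * \<alpha> - real (prefix_sum s n) \<le> 1"
    using sturmian_words_coding[OF assms(2) a1 sw] by blast
  interpret sparse_word s k
  proof
    show "s n \<le> 1" for n by (rule y)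
    show "i + k \<le> j" if "s i = 1" "s j = 1" "i < j" for i j
      by (rule coding_sparse[OF assms(2) ka1 y(2,3) that])
  qed
  have cnt: "int (prefix_sum s (t * m + m - b) - prefix_sum s (t * m + a)) = c" if "t < n" "a + b < k" for t a b
  proof -
    have "int (prefix_sum s (t * m + m - b)) = int (Suc t) * c"
      using that assms(5) by (intro P) (auto simp: of_nat_diff)
    moreover have "int (prefix_sum s (t * m + a)) = int t * c"
      using that by (intro P) auto
    moreover have "prefix_sum s (t * m + a) \<le> prefix_sum s (t * m + m - b)"
      using that assms(5) by (intro prefix_sum_mono) auto
    ultimately show ?thesis by (simp add: of_nat_diff algebra_simps)
  qed
  have "\<forall>j<n. \<forall>j'<n. k_abelian_equiv k (map s [0 + j * m..<0 + j * m + m]) (map s [0 + j' * m..<0 + j' * m + m])"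
    unfolding k_abelian_equiv_blocks_iff[OF assms(5)]
    using cnt by (simp add: add_0) (metis of_nat_eq_iff)
  then obtain w where "occurs_in w s" "k_abelian_power k m n w"
    using k_abelian_power_occurs_iff[of s k m n] by blast
  then show thesis using that n sw unfolding L_def d_def by blast
qed

lemma ab_bounds:
  fixes \<alpha> :: real
  assumes "k > 0" "0 < \<alpha>" "(2 * real k - 1) * \<alpha> < 1" "\<alpha> \<notin> \<rat>" "k \<le> m"
  obtains e where "ab k \<alpha> m = enat e"
    "real e \<le> (1 - (2 * real k - 2) * \<alpha>) / dist_int (real m * \<alpha>) + 2"
    "real e \<ge> (1 - (2 * real k - 2) * \<alpha>) / dist_int (real m * \<alpha>) - 1"
proof -
  define B where "B = (1 - (2 * real k - 2) * \<alpha>) / dist_int (real m * \<alpha>)"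
  have upper: "ab k \<alpha> m \<le> enat (nat \<lfloor>B + 2\<rfloor>)"
    unfolding ab_def
  proof (rule SUP_least)
    fix n assume "n \<in> {n. \<exists>s\<in>sturmian_words \<alpha>. \<exists>w. occurs_in w s \<and> k_abelian_power k m n w}"
    then have "real n \<le> B + 2"
      using k_abelian_power_exponent_le[OF assms] unfolding B_def by blast
    then have "n \<le> nat \<lfloor>B + 2\<rfloor>" by linarith
    then show "enat n \<le> enat (nat \<lfloor>B + 2\<rfloor>)" by simp
  qed
  obtain n s w where n: "real n \<ge> B - 1"
    "s \<in> sturmian_words \<alpha>" "occurs_in w s" "k_abelian_power k m n w"
    using k_abelian_power_exists[OF assms] unfolding B_def by blast
  have lower: "enat n \<le> ab k \<alpha> m"
    unfolding ab_def by (rule SUP_upper) (use n in blast)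
  have nB: "real n \<le> B + 2" 
    using k_abelian_power_exponent_le[OF assms n(2-4)] unfolding B_def .
  obtain e where e: "ab k \<alpha> m = enat e" using upper by (cases "ab k \<alpha> m") auto
  have "e \<le> nat \<lfloor>B + 2\<rfloor>" "n \<le> e" using upper lower unfolding e by simp_all
  \<comment> \<open>Ensures that \<open>nat\<close> does not truncate the bound.\<close>
  moreover have "B + 2 \<ge> 0" using nB by linarith
  ultimately have "real e \<le> B + 2" "real e \<ge> B - 1" using n(1) by linarith+
  then show thesis using that e unfolding B_def by blast
qed

section \<open>The limit superior of the normalized exponents\<close>

lemma limsup_eqI:
  fixes f :: "nat \<Rightarrow> ereal"
  assumes "\<And>e. e > 0 \<Longrightarrow> eventually (\<lambda>n. f n \<le> ereal (l + e)) sequentially"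
    and "\<And>e. e > 0 \<Longrightarrow> frequently (\<lambda>n. f n \<ge> ereal (l - e)) sequentially"
  shows "limsup f = ereal l"
proof (rule antisym)
  show "limsup f \<le> ereal l"
  proof (rule ereal_le_epsilon2)
    fix e :: real assume "0 < e"
    from Limsup_bounded[OF assms(1)[OF this]] show "limsup f \<le> ereal l + ereal e" by simp
  qed
  show "ereal l \<le> limsup f"
  proof (rule ereal_le_epsilon2)
    fix e :: real assume e: "0 < e"
    have "ereal (l - e) \<le> limsup f"
    proof (rule ccontr)
      assume "\<not> ereal (l - e) \<le> limsup f"
      then have "eventually (\<lambda>n. f n < ereal (l - e)) sequentially"
        by (intro Limsup_lessD) (simp add: not_le)
      then show False using assms(2)[OF e] by (simp add: frequently_def not_le)
    qed
    then show "ereal l \<le> limsup f + ereal e" by (cases "limsup f") auto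
  qed
qed

text \<open>By \<open>ab_bounds\<close> the exponent differs from
  \<open>L / \<parallel>m\<alpha>\<parallel>\<close> by a bounded amount, which disappears after
  division by \<open>m\<close>, as do the errors \<open>C / m\<close>.\<close>

lemma A_const_eq:
  fixes \<alpha> \<Lambda> C :: real
  assumes "k > 0" "0 < \<alpha>" "(2 * real k - 1) * \<alpha> < 1" "\<alpha> \<notin> \<rat>" "C > 0"
    and le: "\<And>m. m > 0 \<Longrightarrow> 1 / (real m * dist_int (real m * \<alpha>)) \<le> \<Lambda> + C / real m"
    and ge: "\<And>M. \<exists>m>M. 1 / (real m * dist_int (real m * \<alpha>)) \<ge> \<Lambda> - C / real m"
  shows "A_const k \<alpha> = ereal ((1 - (2 * real k - 2) * \<alpha>) * \<Lambda>)"
  unfolding A_const_def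
proof (rule limsup_eqI)
  define L where "L = 1 - (2 * real k - 2) * \<alpha>"
  have "\<alpha> \<le> L" using assms(3) by (simp add: L_def algebra_simps)
  then have L0: "L > 0" using assms by simp
  \<comment> \<open>The numerator covers the total error on both sides, \<open>L C + 2\<close> above
    and \<open>L C + 1\<close> below.\<close>
  have small: "\<exists>M>0. \<forall>m\<ge>M. (L * C + 2) / real m \<le> e" if "e > 0" for e :: real
  proof -
    obtain M :: nat where M: "real M > (L * C + 2) / e" using reals_Archimedean2 by blast
    have "(L * C + 2) / e > 0" using L0 assms(5) that by (simp add: add_pos_pos)
    then have M0: "M > 0" using M by (cases M) auto
    show ?thesis
    proof (intro exI conjI allI impI)
      fix m assume "M \<le> m"
      then have "real m > (L * C + 2) / e" "real m > 0" using M M0 by simp_all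
      then show "(L * C + 2) / real m \<le> e" using that by (simp add: field_simps)
    qed (rule M0)
  qed
  have bounds: "\<exists>r. ereal_of_enat (ab k \<alpha> m) / ereal (real m) = ereal r \<and>
      r \<le> L * (1 / (real m * dist_int (real m * \<alpha>))) + 2 / real m \<and>
      r \<ge> L * (1 / (real m * dist_int (real m * \<alpha>))) - 1 / real m" if km: "m \<ge> k" for m
  proof -
    have m0: "m > 0" using assms(1) km by simp
    obtain e where e: "ab k \<alpha> m = enat e"
      "real e \<le> L / dist_int (real m * \<alpha>) + 2" "real e \<ge> L / dist_int (real m * \<alpha>) - 1"
      using ab_bounds[OF assms(1-4) km] unfolding L_def by blast
    have "real e / real m \<le> (L / dist_int (real m * \<alpha>) + 2) / real m"
      "real e / real m \<ge> (L / dist_int (real m * \<alpha>) - 1) / real m"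
      using e(2,3) by (intro divide_right_mono; simp)+
    moreover have "ereal_of_enat (ab k \<alpha> m) / ereal (real m) = ereal (real e / real m)"
      using m0 by (simp add: e(1))
    ultimately show ?thesis
      by (intro exI[of _ "real e / real m"]) (simp add: add_divide_distrib diff_divide_distrib mult.commute)
  qed
  fix e :: real assume e: "e > 0"
  obtain M where M: "M > 0" "\<And>m. m \<ge> M \<Longrightarrow> (L * C + 2) / real m \<le> e" using small[OF e] by blast
  show "eventually (\<lambda>m. ereal_of_enat (ab k \<alpha> m) / ereal (real m)
      \<le> ereal ((1 - (2 * real k - 2) * \<alpha>) * \<Lambda> + e)) sequentially"
  proof (rule eventually_sequentiallyI[of "max M k"])
    fix m assume m: "max M k \<le> m"
    then have km: "k \<le> m" by simp
    obtain r where r: "ereal_of_enat (ab k \<alpha> m) / ereal (real m) = ereal r"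
      "r \<le> L * (1 / (real m * dist_int (real m * \<alpha>))) + 2 / real m" using bounds[OF km] by blast
    have "L * (1 / (real m * dist_int (real m * \<alpha>))) \<le> L * (\<Lambda> + C / real m)"
      using le[of m] m M(1) L0 by (intro mult_left_mono) auto
    then have "r \<le> L * \<Lambda> + (L * C + 2) / real m"
      using r(2) by (simp add: algebra_simps add_divide_distrib)
    then have "r \<le> L * \<Lambda> + e" using M(2)[of m] m by simp
    then show "ereal_of_enat (ab k \<alpha> m) / ereal (real m)
      \<le> ereal ((1 - (2 * real k - 2) * \<alpha>) * \<Lambda> + e)" unfolding r L_def by simp
  qed
  show "frequently (\<lambda>m. ereal_of_enat (ab k \<alpha> m) / ereal (real m)
      \<ge> ereal ((1 - (2 * real k - 2) * \<alpha>) * \<Lambda> - e)) sequentially"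
    unfolding frequently_sequentially
  proof
    fix N
    obtain m where m: "m > max N (max M k)"
      "1 / (real m * dist_int (real m * \<alpha>)) \<ge> \<Lambda> - C / real m" using ge by blast
    then have km: "k \<le> m" by simp
    obtain r where r: "ereal_of_enat (ab k \<alpha> m) / ereal (real m) = ereal r"
      "r \<ge> L * (1 / (real m * dist_int (real m * \<alpha>))) - 1 / real m" using bounds[OF km] by blast
    have "L * (1 / (real m * dist_int (real m * \<alpha>))) \<ge> L * (\<Lambda> - C / real m)"
      using m L0 by (intro mult_left_mono) auto
    then have "r \<ge> L * \<Lambda> - (L * C + 1) / real m"
      using r(2) by (simp add: algebra_simps add_divide_distrib)
    moreover have "(L * C + 1) / real m \<le> (L * C + 2) / real m"
      by (intro divide_right_mono) auto
    moreover have "(L * C + 2) / real m \<le> e" using M(2)[of m] m by simp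
    ultimately have "r \<ge> L * \<Lambda> - e" by linarith
    then show "\<exists>m\<ge>N. ereal_of_enat (ab k \<alpha> m) / ereal (real m)
      \<ge> ereal ((1 - (2 * real k - 2) * \<alpha>) * \<Lambda> - e)"
      using r(1) m(1) unfolding L_def by (intro exI[of _ m]) auto
  qed
qed

section \<open>Choice of the metallic mean and of the slope\<close>

text \<open>The least \<open>n\<close> with value above \<open>t\<close> works: for
  \<open>n = 1\<close> by the hypothesis on \<open>t\<close>, otherwise because the preceding value
  is at most \<open>t\<close> and consecutive values have ratio below \<open>3\<close>.\<close>

lemma sqrt_square_add_4_between:
  fixes k :: nat
  assumes "k > 1" "sqrt 5 / (2 * real k - 1) < t"
  obtains n :: nat where "n > 0" "t < sqrt (real n ^ 2 + 4)" "sqrt (real n ^ 2 + 4) < (2 * real k - 1) * t"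
proof -
  have k3: "2 * real k - 1 \<ge> 3" using assms(1) by simp
  have t5: "sqrt 5 < (2 * real k - 1) * t" using assms(2) k3 by (simp add: field_simps)
  have "sqrt 5 / (2 * real k - 1) > 0" using k3 by simp
  then have t0: "t > 0" using assms(2) by linarith
  obtain N :: nat where N: "real N > t" using reals_Archimedean2 by blast
  have ex: "\<exists>n. n > 0 \<and> t < sqrt (real n ^ 2 + 4)"
  proof (intro exI conjI)
    show "N > 0" using N t0 by (cases N) auto
    have "real N \<le> sqrt (real N ^ 2 + 4)" by (rule real_le_rsqrt) simp
    then show "t < sqrt (real N ^ 2 + 4)" using N by simp
  qed
  define n where "n = (LEAST n. n > 0 \<and> t < sqrt (real n ^ 2 + 4))"
  have n: "n > 0" "t < sqrt (real n ^ 2 + 4)" using LeastI_ex[OF ex] by (auto simp: n_def)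
  show thesis
  proof (cases "n = 1")
    case True
    then show thesis using that[of n] n t5 by simp
  next
    case False
    then obtain l where l: "n = Suc l" "l > 0" using n(1) by (cases n) auto
    have "\<not> (l > 0 \<and> t < sqrt (real l ^ 2 + 4))"
      using not_less_Least[of l "\<lambda>n. n > 0 \<and> t < sqrt (real n ^ 2 + 4)"] l by (simp add: n_def[symmetric])
    then have tl: "sqrt (real l ^ 2 + 4) \<le> t" using l by simp
    have "sqrt (real n ^ 2 + 4) < sqrt (3 ^ 2 * (real l ^ 2 + 4))"
    proof (rule real_sqrt_less_mono)
      have "real l \<le> real l ^ 2" using l by (simp add: power2_eq_square)
      then show "real n ^ 2 + 4 < 3 ^ 2 * (real l ^ 2 + 4)"
        unfolding l(1) by (simp add: power2_eq_square algebra_simps)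
    qed
    also have "\<dots> = 3 * sqrt (real l ^ 2 + 4)" by (simp only: real_sqrt_mult real_sqrt_abs abs_numeral)
    also have "\<dots> \<le> (2 * real k - 1) * t" using tl k3 t0 by (intro mult_mono) auto
    finally show thesis using that n by blast
  qed
qed

theorem theorem3p15:
  fixes k :: nat
  assumes "k > 1"
  shows "{sqrt 5 / (2 * real k - 1)<..} \<subseteq>
           closure (Lagrange_spectrum k \<inter> {sqrt 5 / (2 * real k - 1)<..})"
proof
  fix t assume t: "t \<in> {sqrt 5 / (2 * real k - 1)<..}"
  define b where "b = sqrt 5 / (2 * real k - 1)"
  show "t \<in> closure (Lagrange_spectrum k \<inter> {sqrt 5 / (2 * real k - 1)<..})"
    unfolding closure_approachable b_def[symmetric]
  proof (intro allI impI)
    fix e :: real assume e: "e > 0"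
    obtain n :: nat where n: "n > 0" "t < sqrt (real n ^ 2 + 4)"
      "sqrt (real n ^ 2 + 4) < (2 * real k - 1) * t"
      using sqrt_square_add_4_between[OF assms] t by auto
    define \<Lambda> where "\<Lambda> = sqrt (real n ^ 2 + 4)"
    have L0: "\<Lambda> > 0" by (simp add: \<Lambda>_def add_nonneg_pos)
    define q where "q = 2 * real k - 2"
    have q0: "q > 0" using assms by (simp add: q_def)
    \<comment> \<open>The solution of \<open>(1 - q \<beta>) \<Lambda> = t\<close>. The choice of
      \<open>n\<close> gives \<open>0 < \<beta> < 1 / (q + 1)\<close>, the range of slopes in which
      \<open>A_const_eq\<close> applies.\<close>
    define \<beta> where "\<beta> = (1 - t / \<Lambda>) / q"
    have \<beta>: "\<beta> > 0" "(q + 1) * \<beta> < 1" "(1 - q * \<beta>) * \<Lambda> = t"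
    proof -
      show "\<beta> > 0" using n(2) L0 q0 by (simp add: \<beta>_def \<Lambda>_def[symmetric])
      show "(1 - q * \<beta>) * \<Lambda> = t" using L0 q0 by (simp add: \<beta>_def)
      have "\<Lambda> < (q + 1) * t" using n(3) by (simp add: \<Lambda>_def q_def)
      then have "(q + 1) * (t / \<Lambda>) > 1" using L0 by (simp add: field_simps)
      then have "(q + 1) * (1 - t / \<Lambda>) < q" by (simp add: algebra_simps)
      then show "(q + 1) * \<beta> < 1" using q0 by (simp add: \<beta>_def pos_divide_less_eq)
    qed
    \<comment> \<open>The map from \<open>\<alpha>\<close> to
      \<open>(1 - q \<alpha>) \<Lambda>\<close> scales distances by \<open>q \<Lambda>\<close>. The
      term \<open>t - b\<close> keeps the approximating point itself above \<open>b\<close>.\<close>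
    define \<delta> where "\<delta> = min e (t - b) / (q * \<Lambda>)"
    have d0: "\<delta> > 0" using e t q0 L0 by (simp add: \<delta>_def b_def)
    have "\<beta> < 1 / (q + 1)" using \<beta>(2) q0 by (simp add: field_simps)
    then have lt: "max 0 (\<beta> - \<delta>) < min (1 / (q + 1)) (\<beta> + \<delta>)" using \<beta>(1) d0 q0 by auto
    obtain \<alpha> C where \<alpha>: "max 0 (\<beta> - \<delta>) < \<alpha>" "\<alpha> < min (1 / (q + 1)) (\<beta> + \<delta>)" "\<alpha> \<notin> \<rat>" "C > 0"
      "\<And>m. m > 0 \<Longrightarrow> 1 / (real m * dist_int (real m * \<alpha>)) \<le> \<Lambda> + C / real m"
      "\<And>M. \<exists>m>M. 1 / (real m * dist_int (real m * \<alpha>)) \<ge> \<Lambda> - C / real m"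
      using lagrange_dense[OF n(1) lt] unfolding \<Lambda>_def by blast
    have q1: "q + 1 = 2 * real k - 1" by (simp add: q_def)
    have "(q + 1) * \<alpha> < 1" using \<alpha>(2) q0 by (simp add: field_simps)
    then have "A_const k \<alpha> = ereal ((1 - q * \<alpha>) * \<Lambda>)"
      using A_const_eq[of k \<alpha> C \<Lambda>] assms \<alpha> unfolding q1 q_def by simp
    then have mem: "(1 - q * \<alpha>) * \<Lambda> \<in> Lagrange_spectrum k"
      using \<alpha>(3) unfolding Lagrange_spectrum_def by blast
    have "(1 - q * \<alpha>) * \<Lambda> - t = (q * \<Lambda>) * (\<beta> - \<alpha>)"
      unfolding \<beta>(3)[symmetric] by (simp add: algebra_simps)
    then have "\<bar>(1 - q * \<alpha>) * \<Lambda> - t\<bar> = (q * \<Lambda>) * \<bar>\<beta> - \<alpha>\<bar>"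
      using q0 L0 by (simp add: abs_mult)
    also have "\<dots> < (q * \<Lambda>) * \<delta>"
      using \<alpha>(1,2) q0 L0 by (intro mult_strict_left_mono) auto
    also have "\<dots> = min e (t - b)" using q0 L0 by (simp add: \<delta>_def)
    finally have "\<bar>(1 - q * \<alpha>) * \<Lambda> - t\<bar> < min e (t - b)" .
    then have "dist ((1 - q * \<alpha>) * \<Lambda>) t < e" "(1 - q * \<alpha>) * \<Lambda> > b"
      by (auto simp: dist_real_def)
    then show "\<exists>y\<in>Lagrange_spectrum k \<inter> {b<..}. dist y t < e" using mem by auto
  qed
qed

end
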